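(* The visibility function $V:\mathcal{H}\to\{0,1\}$ is upper-semicontinuous with respect to $d_R$; that is, if $H^{(n)}\to H$ with respect to $d_R$ in $\mathcal{H}$ and $V(H^{(n)})=1$ for all $n$, then $V(H)=1$.
   Context: Let $\mathbb{R}^\epsilon=\{a+b\epsilon:a,b\in\mathbb{R}\}$ be the two-dimensional real vector space with basis $\{1,\epsilon\}$, totally ordered by $a+b\epsilon<c+d\epsilon$ iff $a<c$, or $a=c$ and $b<d$; intervals in $\mathbb{R}^\epsilon$ are taken with respect to this order. An infinite hallway is a set $H=\bigcup_{i\ge 0}\{i\}\times(\mathbb{R}^\epsilon\setminus D_i)\subset\mathbb{R}\times\mathbb{R}^\epsilon$, where $D_i=(d_i,d_i+1)\subset\mathbb{R}^\epsilon$ with $d_i\in\mathbb{Z}$ for $i\ge 0$ (the $i$th doorway); it is assumed throughout that $D_0=(0,1)$. $\mathcal{H}$ is the set of all infinite hallways. For $\alpha,\beta\in\mathbb{R}$ let $\ell_{\alpha\beta}=\{(x,\alpha x+\beta):x\in\mathbb{R}\}$ and $\ell^\epsilon_{\alpha\beta}=\{(x,\alpha x+\beta+t\epsilon):x,t\in\mathbb{R}\}$, and for $(x,y)\in\mathbb{R}\times\mathbb{R}^\epsilon$ let $\mathrm{proj}_\alpha(x,y)=y-\alpha x$. Define $\ell^\epsilon_{\alpha\beta}\vee H=\{a\in\mathbb{R}: a+b\epsilon\in \mathrm{proj}_\alpha(\ell^\epsilon_{\alpha\beta})\cap(\mathbb{R}^\epsilon\setminus\mathrm{proj}_\alpha(H))\text{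 for some }b\in\mathbb{R}\}$; $\ell^\epsilon_{\alpha\beta}$ is a line of sight for $H$ if $\ell^\epsilon_{\alpha\beta}\vee H\neq\emptyset$. $V(H)=1$ if $H$ admits a line of sight and $V(H)=0$ otherwise. Definition of $d_R$. For $H\ne H'$ in $\mathcal{H}$ with doorways $D_i=(d_i,d_i+1)$, $D_i'$, let $n=\min\{k: D_k\neq D_k'\}\ge 1$. The common initial segment $\mathrm{comm}(H,H')$ is the finite hallway with the shared doorways $D_0,\dots,D_{n-1}$; it admits a line of sight if there are $\alpha,\beta\in\mathbb{R}$ with $d_i<\alpha i+\beta<d_i+1$ for $0\le i\le n-1$. The unframed hallway $\bar H$ is obtained from $H$ by replacing each doorway $(d_i,d_i+1)$ by $[d_i,d_i+1]$; a real line $\ell_{\alpha\beta}$ is a line of sight for $\mathrm{comm}(\bar H,\bar H')$ if $d_i\le\alpha i+\beta\le d_i+1$ for $0\le i\le n-1$. Set $d_R(H,H)=0$; if $H\neq H'$ and $\mathrm{comm}(H,H')$ admits a line of sight, set $d_R(H,H')=\max\{\tfrac1q: q\in\mathbb{Z}_{>0},\ \ell_{\frac pq\beta}\text{ is a line of sight for }\mathrm{comm}(\bar H,\bar H')\text{ for some }\beta\in\mathbb{R},p\in\mathbb{Z}\}$; if $H\ne H'$ and $\mathrm{comm}(H,H')$ admits no line of sight, set $d_R(H,H')=\infty$. $H^{(n)}\to H$ with respect to $d_R$ means $d_R(H^{(n)},H)\to 0$. *)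

theory Defs
  imports Complex_Main "HOL-Library.Extended_Real"
begin

(* Reps a b stands for a + b \<epsilon>. *)
datatype reps = Reps (std_part: real) (eps_part: real)

instantiation reps :: real_vector
begin

definition "0 = Reps 0 0"
definition "x + y = Reps (std_part x + std_part y) (eps_part x + eps_part y)"
definition "- x = Reps (- std_part x) (- eps_part x)"
definition "x - y = Reps (std_part x - std_part y) (eps_part x - eps_part y)"
definition "r *\<^sub>R x = Reps (r * std_part x) (r * eps_part x)"

instance
  by standard
    (auto simp: zero_reps_def plus_reps_def uminus_reps_def minus_reps_def scaleR_reps_def
      algebra_simps reps.expand)

end

instantiation reps :: linorder
begin

definition "x < y \<longleftrightarrow>
  std_part x < std_part y \<or> (std_part x = std_part y \<and> eps_part x < eps_part y)"
definition "x \<le> y \<longleftrightarrow> x < y \<or> x = (y :: reps)"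

instance
  by standard (auto simp: less_reps_def less_eq_reps_def intro: reps.expand)

end

definition of_std :: "real \<Rightarrow> reps" where
  "of_std a = Reps a 0"

definition eps :: reps where
  "eps = Reps 0 1"

lemma Reps_eq: "Reps a b = of_std a + b *\<^sub>R eps"
  by (simp add: of_std_def eps_def plus_reps_def scaleR_reps_def)

definition doorway :: "int \<Rightarrow> reps set" where
  "doorway d = {of_std (of_int d) <..< of_std (of_int d + 1)}"

definition hallway :: "(nat \<Rightarrow> int) \<Rightarrow> (real \<times> reps) set" where
  "hallway d = (\<Union>i. {real i} \<times> (UNIV - doorway (d i)))"

definition hallways :: "(real \<times> reps) set set" where
  "hallways = {hallway d | d. d 0 = 0}"

lemma doorway_inj: "doorway d = doorway e \<longleftrightarrow> d = e"
proof
  assume "doorway d = doorway e"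
  moreover have "of_std (of_int k + 1 / 2) \<in> doorway l \<longleftrightarrow> k = l" for k l
  proof -
    have "real_of_int l < of_int k + 1 / 2 \<and> real_of_int k + 1 / 2 < of_int l + 1 \<longleftrightarrow> k = l"
      by linarith
    then show ?thesis
      by (simp add: doorway_def of_std_def less_reps_def)
  qed
  ultimately show "d = e"
    by blast
qed simp

lemma hallway_inj: "hallway d = hallway e \<longleftrightarrow> d = e"
proof
  assume eq: "hallway d = hallway e"
  have slice: "doorway (f i) = {y. (real i, y) \<notin> hallway f}" for f i
    by (auto simp: hallway_def)
  have "doorway (d i) = doorway (e i)" for i
    using slice[of d i] slice[of e i] eq by simp
  then show "d = e"
    by (auto simp: doorway_inj)
qed simp

(* The doorway positions of a hallway; well defined by hallway_inj. *)
definition door_pos :: "(real \<times> reps) set \<Rightarrow> nat \<Rightarrow> int" where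
  "door_pos H = (THE d. H = hallway d)"

lemma door_pos_hallway [simp]: "door_pos (hallway d) = d"
  by (auto simp: door_pos_def hallway_inj)

definition eps_line :: "real \<Rightarrow> real \<Rightarrow> (real \<times> reps) set" where
  "eps_line \<alpha> \<beta> = {(x, of_std (\<alpha> * x + \<beta>) + t *\<^sub>R eps) | x t. True}"

definition proj :: "real \<Rightarrow> real \<times> reps \<Rightarrow> reps" where
  "proj \<alpha> = (\<lambda>(x, y). y - of_std (\<alpha> * x))"

(* The real set written with the join symbol, for the line with slope \<alpha> and intercept \<beta>. *)
definition vee :: "real \<Rightarrow> real \<Rightarrow> (real \<times> reps) set \<Rightarrow> real set" where
  "vee \<alpha> \<beta> H =
    {a. \<exists>b. of_std a + b *\<^sub>R eps \<in> proj \<alpha> ` eps_line \<alpha> \<beta> \<inter> (UNIV - proj \<alpha> ` H)}"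

definition line_of_sight :: "real \<Rightarrow> real \<Rightarrow> (real \<times> reps) set \<Rightarrow> bool" where
  "line_of_sight \<alpha> \<beta> H \<longleftrightarrow> vee \<alpha> \<beta> H \<noteq> {}"

definition visibility :: "(real \<times> reps) set \<Rightarrow> nat" where
  "visibility H = (if \<exists>\<alpha> \<beta>. line_of_sight \<alpha> \<beta> H then 1 else 0)"

(* A finite hallway is given by the list of its doorway positions. *)
definition comm :: "(real \<times> reps) set \<Rightarrow> (real \<times> reps) set \<Rightarrow> int list" where
  "comm H H' =
    map (door_pos H) [0..<(LEAST k. doorway (door_pos H k) \<noteq> doorway (door_pos H' k))]"

definition fin_line_of_sight :: "real \<Rightarrow> real \<Rightarrow> int list \<Rightarrow> bool" where
  "fin_line_of_sight \<alpha> \<beta> ds \<longleftrightarrow>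
    (\<forall>i < length ds. ds ! i < \<alpha> * i + \<beta> \<and> \<alpha> * i + \<beta> < ds ! i + 1)"

(* Line of sight for the unframed version of the finite hallway, with closed real doorways. *)
definition fin_line_of_sight_unframed :: "real \<Rightarrow> real \<Rightarrow> int list \<Rightarrow> bool" where
  "fin_line_of_sight_unframed \<alpha> \<beta> ds \<longleftrightarrow>
    (\<forall>i < length ds. ds ! i \<le> \<alpha> * i + \<beta> \<and> \<alpha> * i + \<beta> \<le> ds ! i + 1)"

(* Max is unusable here: the set of admissible 1 / q is infinite. It still has a greatest
   element, by unframed_greatest_exists below. *)
definition dR :: "(real \<times> reps) set \<Rightarrow> (real \<times> reps) set \<Rightarrow> ereal" where
  "dR H H' =
    (if H = H' then 0
     else if \<exists>\<alpha> \<beta>. fin_line_of_sight \<alpha> \<beta> (comm H H')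
     then ereal (GREATEST r. \<exists>(q::int) > 0. r = 1 / of_int q \<and>
       (\<exists>(p::int) \<beta>. fin_line_of_sight_unframed (of_int p / of_int q) \<beta> (comm H H')))
     else \<infinity>)"

lemma unframed_rational_slope_exists:
  assumes "fin_line_of_sight \<alpha> \<beta> ds"
  shows "\<exists>(q::int) > 0. \<exists>(p::int) \<beta>. fin_line_of_sight_unframed (of_int p / of_int q) \<beta> ds"
proof -
  have "eventually (\<lambda>a. \<forall>i\<in>{..<length ds}. ds ! i < a * i + \<beta> \<and> a * i + \<beta> < ds ! i + 1)
      (nhds \<alpha>)"
  proof (intro eventually_ball_finite ballI eventually_conj)
    fix i assume i: "i \<in> {..<length ds}"
    have lim: "((\<lambda>a. a * real i + \<beta>) \<longlongrightarrow> \<alpha> * real i + \<beta>) (nhds \<alpha>)"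
      by (intro tendsto_intros filterlim_ident)
    show "\<forall>\<^sub>F a in nhds \<alpha>. ds ! i < a * real i + \<beta>"
      using i assms by (intro order_tendstoD(1)[OF lim]) (auto simp: fin_line_of_sight_def)
    show "\<forall>\<^sub>F a in nhds \<alpha>. a * real i + \<beta> < ds ! i + 1"
      using i assms by (intro order_tendstoD(2)[OF lim]) (auto simp: fin_line_of_sight_def)
  qed simp
  then obtain e where "e > 0" and e: "\<And>a i. dist a \<alpha> < e \<Longrightarrow> i < length ds \<Longrightarrow>
      ds ! i < a * real i + \<beta> \<and> a * real i + \<beta> < ds ! i + 1"
    unfolding eventually_nhds_metric by force
  obtain a where "a \<in> \<rat>" "\<alpha> < a" "a < \<alpha> + e"
    using Rats_dense_in_real[of \<alpha> "\<alpha> + e"] \<open>e > 0\<close> by auto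
  moreover then obtain p q :: int where "q > 0" "a = of_int p / of_int q"
    by (metis Rats_cases')
  ultimately have "fin_line_of_sight_unframed (of_int p / of_int q) \<beta> ds"
    using e[of a] by (force simp: fin_line_of_sight_unframed_def dist_real_def)
  then show ?thesis
    using \<open>q > 0\<close> by blast
qed

lemma unframed_greatest_exists:
  assumes "fin_line_of_sight \<alpha> \<beta> ds"
  defines "S \<equiv> {r::real. \<exists>(q::int) > 0. r = 1 / of_int q \<and>
    (\<exists>(p::int) \<beta>. fin_line_of_sight_unframed (of_int p / of_int q) \<beta> ds)}"
  shows "\<exists>r\<in>S. \<forall>s\<in>S. s \<le> r"
proof -
  define P where "P n \<longleftrightarrow> n > 0 \<and>
    (\<exists>(p::int) \<beta>. fin_line_of_sight_unframed (of_int p / of_int (int n)) \<beta> ds)" for n :: nat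
  obtain q p :: int and \<beta>' where
    "q > 0" "fin_line_of_sight_unframed (of_int p / of_int q) \<beta>' ds"
    using unframed_rational_slope_exists[OF assms(1)] by blast
  then have "P (nat q)"
    by (auto simp: P_def)
  then obtain m where m: "P m" "\<And>n. P n \<Longrightarrow> m \<le> n"
    by (metis LeastI Least_le)
  have "m > 0"
    using m(1) by (simp add: P_def)
  have "1 / of_int (int m) \<in> S"
    unfolding S_def using m(1) unfolding P_def
    by (intro CollectI exI[of _ "int m"]) auto
  moreover have "s \<le> 1 / of_int (int m)" if s: "s \<in> S" for s
  proof -
    obtain k p :: int and \<gamma> where k: "k > 0" "s = 1 / of_int k"
      "fin_line_of_sight_unframed (of_int p / of_int k) \<gamma> ds"
      using s unfolding S_def by blast
    then have "P (nat k)"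
      by (auto simp: P_def)
    then have "int m \<le> k"
      using m(2)[of "nat k"] k(1) by linarith
    then have "real m \<le> of_int k"
      by linarith
    then show ?thesis
      using k \<open>m > 0\<close> by (auto intro!: divide_left_mono)
  qed
  ultimately show ?thesis
    by blast
qed

end

theory Submission
  imports Defs "HOL-Analysis.Elementary_Metric_Spaces"
begin

text \<open>
  A line with an \<open>\<epsilon>\<close>-shift sees through every open doorway as soon as the real line
  \<open>\<alpha> x + \<beta>\<close> stays in the closed doorways and does not touch both a left and a right endpoint:
  the shift moves all the touching points into the doorways at once. A line of irrational slope
  passes through at most one lattice point, so it touches at most one endpoint. Hence a hallway is
  visible as soon as its closed doorways admit a line of irrational slope
  (\<open>visibility_irrational_slope\<close>).

  Let \<open>Hs n \<rightarrow> H\<close>; if some \<open>Hs n\<close> equals \<open>H\<close>, there is nothing to prove. Otherwise a line of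
  slope \<open>p / q\<close> through closed doorways of \<open>H\<close> that cover the common segment of \<open>H\<close> and \<open>Hs n\<close>
  keeps the distance at least \<open>1 / q\<close> (\<open>dR_lower_bound\<close>). So the common segments, which admit
  lines of sight, cannot have bounded length, for then a single rational slope would serve all of
  them (\<open>prefix_sight_of_limit\<close>). By compactness the closed doorways of \<open>H\<close> admit a line, and
  by the same lower bound its slope is irrational.
\<close>

lemma line_of_sight_hallwayI:
  assumes "\<And>i. Reps (\<alpha> * real i + \<beta>) t \<in> doorway (d i)"
  shows "line_of_sight \<alpha> \<beta> (hallway d)"
proof -
  let ?y = "of_std \<beta> + t *\<^sub>R eps"
  have "?y = proj \<alpha> (0, of_std (\<alpha> * 0 + \<beta>) + t *\<^sub>R eps)"
    by (simp add: proj_def of_std_def eps_def plus_reps_def minus_reps_def scaleR_reps_def)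
  then have "?y \<in> proj \<alpha> ` eps_line \<alpha> \<beta>"
    unfolding eps_line_def by blast
  moreover have "?y \<notin> proj \<alpha> ` hallway d"
  proof
    assume "?y \<in> proj \<alpha> ` hallway d"
    then obtain i y where y: "y \<notin> doorway (d i)" "?y = y - of_std (\<alpha> * real i)"
      by (auto simp: hallway_def proj_def)
    have "y = Reps (\<alpha> * real i + \<beta>) t"
      using y(2) by (cases y) (simp add: of_std_def eps_def plus_reps_def minus_reps_def scaleR_reps_def)
    then show False
      using y(1) assms by simp
  qed
  ultimately show ?thesis
    by (auto simp: line_of_sight_def vee_def)
qed

text \<open>
  Two lattice points on the line would make its slope a quotient of integers. At the only index
  \<open>j\<close> where the line can touch an endpoint, the sign of the shift is chosen to point inwards.
\<close>
lemma visibility_irrational_slope: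
  assumes "\<alpha> \<notin> \<rat>"
    and sight: "\<And>i. of_int (d i) \<le> \<alpha> * real i + \<beta> \<and> \<alpha> * real i + \<beta> \<le> of_int (d i) + 1"
  shows "visibility (hallway d) = 1"
proof -
  have unique: "i = j" if ij: "\<alpha> * real i + \<beta> \<in> \<int>" "\<alpha> * real j + \<beta> \<in> \<int>" for i j
  proof (rule ccontr)
    assume "i \<noteq> j"
    have "(\<alpha> * real i + \<beta>) - (\<alpha> * real j + \<beta>) \<in> \<rat>"
      using ij Ints_subset_Rats by (intro Rats_diff) auto
    then have "(\<alpha> * (real i - real j)) / (real i - real j) \<in> \<rat>"
      by (intro Rats_divide) (auto simp: algebra_simps)
    then show False
      using assms(1) \<open>i \<noteq> j\<close> by simp
  qed
  have "\<exists>t. \<forall>i. Reps (\<alpha> * real i + \<beta>) t \<in> doorway (d i)"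
  proof (cases "\<exists>j. \<alpha> * real j + \<beta> = of_int (d j)")
    case True
    then obtain j where j: "\<alpha> * real j + \<beta> = of_int (d j)" ..
    have "\<alpha> * real i + \<beta> \<noteq> of_int (d i) + 1" for i
    proof
      assume i: "\<alpha> * real i + \<beta> = of_int (d i) + 1"
      then have "i = j"
        using j by (intro unique) auto
      then show False
        using i j by simp
    qed
    then have "Reps (\<alpha> * real i + \<beta>) 1 \<in> doorway (d i)" for i
      using sight[of i] by (auto simp: doorway_def of_std_def less_reps_def less_le)
    then show ?thesis by blast
  next
    case False
    then have "Reps (\<alpha> * real i + \<beta>) (- 1) \<in> doorway (d i)" for i
      using sight[of i] by (simp add: doorway_def of_std_def less_reps_def less_le) metis
    then show ?thesis by blast
  qed
  then have "line_of_sight \<alpha> \<beta> (hallway d)"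
    using line_of_sight_hallwayI by blast
  then show ?thesis
    by (auto simp: visibility_def)
qed

text \<open>The first two doorways confine slope and intercept to a compact rectangle.\<close>
lemma sight_of_prefix_sights:
  assumes "\<And>N. \<exists>\<alpha> \<beta>. fin_line_of_sight_unframed \<alpha> \<beta> (map d [0..<N])"
  shows "\<exists>\<alpha> \<beta>. \<forall>i. of_int (d i) \<le> \<alpha> * real i + \<beta> \<and> \<alpha> * real i + \<beta> \<le> of_int (d i) + 1"
proof -
  define F where "F i = {x :: real \<times> real. of_int (d i) \<le> fst x * real i + snd x
    \<and> fst x * real i + snd x \<le> of_int (d i) + 1}" for i
  define K :: "(real \<times> real) set" where
    "K = {of_int (d 1) - of_int (d 0) - 1 .. of_int (d 1) - of_int (d 0) + 1}
      \<times> {of_int (d 0) .. of_int (d 0) + 1}"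
  have compact: "compact K"
    unfolding K_def by (intro compact_Times compact_Icc)
  have closed: "closed (F i)" for i
    unfolding F_def by (intro closed_Collect_conj closed_Collect_le continuous_intros)
  have fip: "K \<inter> (\<Inter>i\<in>I. F i) \<noteq> {}" if "finite I" for I
  proof -
    obtain m where m: "\<forall>i\<in>I. i \<le> m"
      using \<open>finite I\<close> finite_nat_set_iff_bounded_le by auto
    \<comment> \<open>A length of at least 2 brings in the two doorways that define \<open>K\<close>.\<close>
    obtain \<alpha> \<beta> where "fin_line_of_sight_unframed \<alpha> \<beta> (map d [0..<m + 2])"
      using assms by blast
    then have F: "(\<alpha>, \<beta>) \<in> F i" if "i < m + 2" for i
      using that by (auto simp: fin_line_of_sight_unframed_def F_def simp del: upt_Suc)
    have "(\<alpha>, \<beta>) \<in> K"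
      using F[of 0] F[of 1] by (auto simp: F_def K_def)
    moreover have "(\<alpha>, \<beta>) \<in> F i" if "i \<in> I" for i
      using F[of i] m that by fastforce
    ultimately show ?thesis by blast
  qed
  have "K \<inter> (\<Inter>i\<in>UNIV. F i) \<noteq> {}"
    by (rule compact_imp_fip_image[OF compact closed fip])
  then show ?thesis
    by (auto simp: F_def)
qed

definition first_diff :: "(nat \<Rightarrow> int) \<Rightarrow> (nat \<Rightarrow> int) \<Rightarrow> nat" where
  "first_diff e d = (LEAST k. e k \<noteq> d k)"

text \<open>On the common segment the two hallways agree, so it can be read off the second one.\<close>
lemma comm_hallway: "comm (hallway e) (hallway d) = map d [0..<first_diff e d]"
proof -
  have "e k = d k" if "k < first_diff e d" for k
    using not_less_Least[OF that[unfolded first_diff_def]] by simp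
  then show ?thesis
    by (simp add: comm_def doorway_inj flip: first_diff_def)
qed

lemma fin_line_of_sight_unframed_prefix:
  assumes "fin_line_of_sight_unframed \<alpha> \<beta> (map d [0..<N])" "m \<le> N"
  shows "fin_line_of_sight_unframed \<alpha> \<beta> (map d [0..<m])"
  using assms by (auto simp: fin_line_of_sight_unframed_def)

lemma dR_lower_bound:
  fixes p q :: int
  assumes "e \<noteq> d" "q > 0"
    and "fin_line_of_sight_unframed (of_int p / of_int q) \<beta> (map d [0..<first_diff e d])"
  shows "ereal (1 / of_int q) \<le> dR (hallway e) (hallway d)"
proof (cases "\<exists>\<alpha> \<beta>. fin_line_of_sight \<alpha> \<beta> (comm (hallway e) (hallway d))")
  case True
  then obtain \<alpha>' \<beta>' where open_sight: "fin_line_of_sight \<alpha>' \<beta>' (comm (hallway e) (hallway d))"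
    by blast
  define P where "P r \<longleftrightarrow> (\<exists>(q::int) > 0. r = 1 / of_int q \<and>
    (\<exists>(p::int) \<beta>. fin_line_of_sight_unframed (of_int p / of_int q) \<beta>
      (comm (hallway e) (hallway d))))" for r :: real
  have "\<exists>r\<in>Collect P. \<forall>s\<in>Collect P. s \<le> r"
    unfolding P_def by (rule unframed_greatest_exists[OF open_sight])
  then obtain r where r: "P r" "\<And>s. P s \<Longrightarrow> s \<le> r"
    by blast
  have "P (1 / of_int q)"
    using assms(2,3) unfolding P_def comm_hallway by blast
  then have "1 / of_int q \<le> Greatest P"
    using Greatest_equality[of P, OF r] r(2) by simp
  moreover have "dR (hallway e) (hallway d) = ereal (Greatest P)"
    unfolding P_def using True assms(1) by (simp add: dR_def hallway_inj)
  ultimately show ?thesis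
    by simp
qed (use assms(1) in \<open>simp add: dR_def hallway_inj\<close>)

text \<open>
  If some segment had no such line, the longest initial segment that has one would contain every
  common segment admitting a line of sight, and its rational slope would bound all distances away
  from 0.
\<close>
lemma prefix_sight_of_limit:
  assumes "\<And>n. e n \<noteq> d" "(\<lambda>n. dR (hallway (e n)) (hallway d)) \<longlonglongrightarrow> 0"
  shows "\<exists>(q::int) > 0. \<exists>(p::int) \<beta>.
    fin_line_of_sight_unframed (of_int p / of_int q) \<beta> (map d [0..<N])"
proof (induction N)
  case 0
  show ?case
    by (intro exI[of _ 1]) (simp add: fin_line_of_sight_unframed_def)
next
  case (Suc N)
  then obtain p q :: int and \<beta> where q: "q > 0"
    and sight: "fin_line_of_sight_unframed (of_int p / of_int q) \<beta> (map d [0..<N])"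
    by blast
  have "\<forall>\<^sub>F n in sequentially. dR (hallway (e n)) (hallway d) < ereal (1 / of_int q)"
    using q by (intro order_tendstoD(2)[OF assms(2)]) simp
  then obtain n where n: "dR (hallway (e n)) (hallway d) < ereal (1 / of_int q)"
    by (auto simp: eventually_sequentially)
  \<comment> \<open>The line for the first \<open>N\<close> doorways forces distances of at least \<open>1 / q\<close> on shorter
    common segments.\<close>
  have longer: "Suc N \<le> first_diff (e n) d"
    using n dR_lower_bound[OF assms(1) q fin_line_of_sight_unframed_prefix[OF sight]]
    by (meson not_less not_less_eq_eq)
  have "\<exists>\<alpha> \<beta>. fin_line_of_sight \<alpha> \<beta> (comm (hallway (e n)) (hallway d))"
    using n assms(1)[of n] by (auto simp: dR_def hallway_inj split: if_splits)
  then show ?case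
    using unframed_rational_slope_exists fin_line_of_sight_unframed_prefix[OF _ longer]
    unfolding comm_hallway by meson
qed

theorem theorem49:
  fixes Hs :: "nat \<Rightarrow> (real \<times> reps) set" and H :: "(real \<times> reps) set"
  assumes "\<And>n. Hs n \<in> hallways"
    and "H \<in> hallways"
    and "(\<lambda>n. dR (Hs n) H) \<longlonglongrightarrow> 0"
    and "\<And>n. visibility (Hs n) = 1"
  shows "visibility H = 1"
proof (cases "\<exists>n. Hs n = H")
  case True
  then show ?thesis
    using assms(4) by blast
next
  case False
  obtain d where H: "H = hallway d"
    using assms(2) by (auto simp: hallways_def)
  have "\<forall>n. \<exists>f. Hs n = hallway f"
    using assms(1) by (auto simp: hallways_def)
  then obtain e where e: "\<And>n. Hs n = hallway (e n)"
    by metis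
  have ne: "e n \<noteq> d" for n
    using False e H by blast
  have lim: "(\<lambda>n. dR (hallway (e n)) (hallway d)) \<longlonglongrightarrow> 0"
    using assms(3) by (simp add: e H)
  obtain \<alpha> \<beta> where sight:
    "\<And>i. of_int (d i) \<le> \<alpha> * real i + \<beta> \<and> \<alpha> * real i + \<beta> \<le> of_int (d i) + 1"
    using sight_of_prefix_sights[of d] prefix_sight_of_limit[OF ne lim] by metis
  have "\<alpha> \<notin> \<rat>"
  proof
    assume "\<alpha> \<in> \<rat>"
    then obtain p q :: int where q: "q > 0" "\<alpha> = of_int p / of_int q"
      by (metis Rats_cases')
    have "fin_line_of_sight_unframed (of_int p / of_int q) \<beta> (map d [0..<first_diff (e n) d])" for n
      using sight by (simp add: fin_line_of_sight_unframed_def flip: q(2))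
    then have "ereal (1 / of_int q) \<le> dR (hallway (e n)) (hallway d)" for n
      using dR_lower_bound[OF ne q(1)] by blast
    then have "ereal (1 / of_int q) \<le> 0"
      using lim by (intro tendsto_lowerbound[OF lim]) auto
    then show False
      using q(1) by simp
  qed
  then show ?thesis
    unfolding H using sight by (rule visibility_irrational_slope)
qed

end
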